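(* Let $X$ be a quasi-spectral space. Then every quasi-component of $X$ is connected; that is, for every $x\in X$ the intersection of all clopen subsets of $X$ containing $x$ is a connected subspace of $X$.
   Context: A topological space is quasi-compact if every open cover has a finite subcover (no Hausdorff condition is assumed). A quasi-spectral space is a quasi-compact topological space $X$ having a basis consisting of quasi-compact open subsets of $X$ such that the intersection of any two members of the basis is quasi-compact. A subset is clopen if it is both open and closed. The quasi-component of a point $x\in X$ is the intersection of all clopen subsets of $X$ containing $x$. Connected spaces are nonempty by convention. *)

theory Defs
  imports "HOL-Analysis.Analysis"
begin

text \<open>Neither \<^const>\<open>compact_space\<close> nor \<^const>\<open>compactin\<close> involves a separation
  axiom, so they express quasi-compactness.  The equation
  \<open>openin X = arbitrary union_of (\<lambda>U. U \<in> B)\<close> says that the open sets of \<open>X\<close> are exactly the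
  unions of members of \<open>B\<close>, that is, \<open>B\<close> is a basis of \<open>X\<close> consisting of open sets.\<close>

definition quasi_spectral_space :: "'a topology \<Rightarrow> bool" where
  "quasi_spectral_space X \<longleftrightarrow>
     compact_space X \<and>
     (\<exists>B. openin X = arbitrary union_of (\<lambda>U. U \<in> B) \<and>
          (\<forall>U\<in>B. compactin X U) \<and>
          (\<forall>U\<in>B. \<forall>V\<in>B. compactin X (U \<inter> V)))"

text \<open>\<^const>\<open>connectedin\<close> admits the empty set; here connected spaces are nonempty.\<close>

definition connected_nonempty_in :: "'a topology \<Rightarrow> 'a set \<Rightarrow> bool" where
  "connected_nonempty_in X S \<longleftrightarrow> S \<noteq> {} \<and> connectedin X S"

end

theory Submission
  imports Defs
begin

text \<open>If open sets disconnect a quasi-component \<open>Q\<close>, the two pieces of \<open>Q\<close> are closed in \<open>X\<close>,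
  hence quasi-compact, so the open sets may be shrunk to finite unions \<open>U\<close>, \<open>V\<close> of basic open
  sets.  Then \<open>U \<inter> V\<close> is quasi-compact and misses \<open>Q\<close>, as does the complement of \<open>U \<union> V\<close>,
  so some clopen \<open>T \<supseteq> Q\<close> misses both.  Now \<open>T\<close> is the disjoint union of the clopen sets
  \<open>T \<inter> U\<close> and \<open>T \<inter> V\<close>, one of which contains \<open>Q\<close>.\<close>

text \<open>The quasi-component is the intersection of all clopen sets containing \<open>x\<close>.
  By the finite intersection property, finitely many of them already have an intersection that
  misses \<open>K\<close>, and that intersection is again clopen.\<close>

lemma compactin_disjoint_quasi_component:
  assumes K: "compactin X K" and x: "x \<in> topspace X"
    and disj: "K \<inter> quasi_component_of_set X x = {}"
  obtains T where "openin X T" "closedin X T" "x \<in> T" "K \<inter> T = {}"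
proof -
  define \<T> where "\<T> = {T. closedin X T \<and> openin X T \<and> x \<in> T}"
  have \<T>: "closedin X T" "openin X T" "x \<in> T" if "T \<in> \<T>" for T
    using that by (auto simp: \<T>_def)
  have "K \<inter> \<Inter>\<T> = {}"
    using disj x by (simp add: quasi_component_of_set \<T>_def)
  then obtain F where F: "finite F" "F \<subseteq> \<T>" "K \<inter> \<Inter>F = {}"
    using K \<T>(1) unfolding compactin_fip by metis
  \<comment> \<open>Adding \<open>topspace X\<close> covers the case of empty \<open>F\<close>,
    where \<open>\<Inter>F\<close> would be the whole type instead of a clopen subset of
    \<open>X\<close>.\<close>
  let ?F = "insert (topspace X) F"
  have "openin X (\<Inter>?F)"
    using F \<T> by (intro openin_Inter) auto
  moreover have "closedin X (\<Inter>?F)"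
    using F \<T> by (intro closedin_Inter) auto
  moreover have "x \<in> \<Inter>?F" "K \<inter> \<Inter>?F = {}"
    using F \<T> x by auto
  ultimately show ?thesis
    by (rule that)
qed

lemma compactin_subset_finite_basis_Union:
  assumes B: "openin X = arbitrary union_of (\<lambda>U. U \<in> B)"
    and K: "compactin X K" "openin X U" "K \<subseteq> U"
  obtains F where "finite F" "F \<subseteq> B" "K \<subseteq> \<Union>F" "\<Union>F \<subseteq> U"
proof -
  obtain W where W: "W \<subseteq> B" "\<Union>W = U"
    using K(2) unfolding B union_of_def arbitrary_def by auto
  have "openin X V" if "V \<in> W" for V
    unfolding B using that W(1) by (intro arbitrary_union_of_inc) auto
  then obtain F where "finite F" "F \<subseteq> W" "K \<subseteq> \<Union>F"
    using K(1,3) W(2) unfolding compactin_def by metis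
  with W show ?thesis
    by (intro that[of F]) auto
qed

text \<open>Intersection distributes over the two unions, leaving a finite union of quasi-compact
  sets. This carries the condition on pairs of basis members over to finite unions of them.\<close>

lemma compactin_Int_Unions:
  assumes "finite F" "finite G"
    and "\<And>U V. U \<in> F \<Longrightarrow> V \<in> G \<Longrightarrow> compactin X (U \<inter> V)"
  shows "compactin X (\<Union>F \<inter> \<Union>G)"
proof -
  have "\<Union>F \<inter> \<Union>G = \<Union>((\<lambda>(U, V). U \<inter> V) ` (F \<times> G))"
    by auto
  moreover have "compactin X \<dots>"
    using assms by (intro compactin_Union) auto
  ultimately show ?thesis
    by simp
qed

text \<open>On \<open>T\<close> the sets \<open>U\<close> and \<open>V\<close> are complementary, so
  \<open>T \<inter> U\<close> is a clopen set containing \<open>x\<close>, and the quasi-component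
  lies in every such set.\<close>

lemma quasi_component_subset_if_disjoint_cover:
  assumes x: "x \<in> U" and U: "openin X U" and V: "openin X V"
    and T: "openin X T" "closedin X T" "x \<in> T" "T \<subseteq> U \<union> V" "T \<inter> (U \<inter> V) = {}"
  shows "quasi_component_of_set X x \<subseteq> U"
proof -
  have "openin X (T \<inter> U)"
    using T U by auto
  moreover have "closedin X (T \<inter> U)"
  proof -
    have "T \<inter> U = T - V"
      using T by auto
    then show ?thesis
      using T V by (simp add: closedin_diff)
  qed
  ultimately show ?thesis
    using x T(3) by (auto simp: quasi_component_of_def)
qed

lemma connectedin_quasi_component_of_quasi_spectral:
  assumes X: "quasi_spectral_space X" and x: "x \<in> topspace X"
  shows "connectedin X (quasi_component_of_set X x)"
proof -
  define Q where "Q = quasi_component_of_set X x"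
  have Q: "Q \<subseteq> topspace X" "closedin X Q"
    unfolding Q_def
    using quasi_component_of_subset_topspace closedin_quasi_component_of by metis+
  obtain B where compact: "compact_space X"
    and B: "openin X = arbitrary union_of (\<lambda>U. U \<in> B)"
    and Int: "\<And>U V. U \<in> B \<Longrightarrow> V \<in> B \<Longrightarrow> compactin X (U \<inter> V)"
    using X unfolding quasi_spectral_space_def by auto
  have openB: "openin X (\<Union>F)" if "F \<subseteq> B" for F
    unfolding B union_of_def arbitrary_def using that by auto
  \<comment> \<open>If \<open>E\<close> and \<open>E'\<close> are disjoint on \<open>Q\<close>, then
    \<open>Q - E'\<close> is the piece \<open>E \<inter> Q\<close>; in this form it is visibly
    closed, hence quasi-compact.\<close>
  have shrink: "\<exists>F. finite F \<and> F \<subseteq> B \<and> Q - E' \<subseteq> \<Union>F \<and> \<Union>F \<subseteq> E"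
    if E: "openin X E" "openin X E'" "Q \<subseteq> E \<union> E'" for E E'
  proof -
    have "compactin X (Q - E')"
      using compact E by (simp add: closedin_compact_space closedin_diff Q)
    moreover have "Q - E' \<subseteq> E"
      using E(3) by blast
    ultimately show ?thesis
      using E(1) compactin_subset_finite_basis_Union[OF B] by metis
  qed
  have False
    if E: "openin X E1" "openin X E2" "Q \<subseteq> E1 \<union> E2" "E1 \<inter> E2 \<inter> Q = {}"
      "E1 \<inter> Q \<noteq> {}" "E2 \<inter> Q \<noteq> {}" for E1 E2
  proof -
    obtain F where F: "finite F" "F \<subseteq> B" "Q - E2 \<subseteq> \<Union>F" "\<Union>F \<subseteq> E1"
      using shrink[OF E(1-3)] by metis
    obtain G where G: "finite G" "G \<subseteq> B" "Q - E1 \<subseteq> \<Union>G" "\<Union>G \<subseteq> E2"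
      using shrink[OF E(2,1)] E(3) by (metis Un_commute)
    define U V where "U = \<Union>F" and "V = \<Union>G"
    have oU: "openin X U" and oV: "openin X V"
      unfolding U_def V_def using F G openB by auto
    have cover: "Q \<subseteq> U \<union> V" and disj: "U \<inter> V \<inter> Q = {}"
      using E(3,4) F(3,4) G(3,4) unfolding U_def[symmetric] V_def[symmetric] by blast+
    \<comment> \<open>If \<open>Q\<close> were inside \<open>U\<close>, it would be inside
      \<open>E1\<close>, and \<open>E2 \<inter> Q\<close> would be empty; likewise for
      \<open>V\<close>.\<close>
    have neU: "\<not> Q \<subseteq> U" and neV: "\<not> Q \<subseteq> V"
      using E(4-6) F(4) G(4) unfolding U_def[symmetric] V_def[symmetric] by blast+
    have "compactin X (U \<inter> V)"
      unfolding U_def V_def using F(1,2) G(1,2) Int by (intro compactin_Int_Unions) auto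
    moreover have "compactin X (topspace X - (U \<union> V))"
      using compact oU oV by (simp add: closedin_compact_space openin_Un closedin_diff)
    ultimately have "compactin X (U \<inter> V \<union> (topspace X - (U \<union> V)))"
      by (rule compactin_Un)
    moreover have "(U \<inter> V \<union> (topspace X - (U \<union> V))) \<inter> Q = {}"
      using cover disj by blast
    ultimately obtain T where T: "openin X T" "closedin X T" "x \<in> T"
      and miss: "(U \<inter> V \<union> (topspace X - (U \<union> V))) \<inter> T = {}"
      using compactin_disjoint_quasi_component[OF _ x, folded Q_def] by metis
    \<comment> \<open>Since \<open>T\<close> lies in \<open>topspace X\<close>, missing the
      complement of \<open>U \<union> V\<close> means being covered by \<open>U\<close> and
      \<open>V\<close>.\<close>
    have TUV: "T \<subseteq> U \<union> V" "T \<inter> (U \<inter> V) = {}"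
      using miss openin_subset[OF T(1)] by blast+
    consider "x \<in> U" | "x \<in> V"
      using T(3) TUV(1) by blast
    then show False
    proof cases
      case 1
      then show False
        using quasi_component_subset_if_disjoint_cover[OF _ oU oV T TUV, folded Q_def] neU by blast
    next
      case 2
      then show False
        using quasi_component_subset_if_disjoint_cover[OF _ oV oU T, folded Q_def] TUV neV by blast
    qed
  qed
  then show ?thesis
    unfolding connectedin Q_def [symmetric] using Q(1) by blast
qed

theorem theorem1p1:
  fixes X :: "'a topology"
  assumes "quasi_spectral_space X"
  shows "(\<forall>Q \<in> quasi_components_of X. connected_nonempty_in X Q) \<and>
         (\<forall>x \<in> topspace X. connected_nonempty_in X (\<Inter>{T. openin X T \<and> closedin X T \<and> x \<in> T}))"
proof -
  \<comment> \<open>Nonemptiness holds because the quasi-component of a point of the space contains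
    that point.\<close>
  have conn: "connected_nonempty_in X (quasi_component_of_set X x)" if "x \<in> topspace X" for x
    unfolding connected_nonempty_in_def
    using that assms connectedin_quasi_component_of_quasi_spectral quasi_component_of_eq_empty
    by metis
  have "quasi_component_of_set X x = \<Inter>{T. openin X T \<and> closedin X T \<and> x \<in> T}"
    if "x \<in> topspace X" for x
    using that by (auto simp: quasi_component_of_set)
  with conn show ?thesis
    by (auto simp: quasi_components_of_def)
qed

end
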